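(* Let $Y$ satisfy the asynchronous ODE $$\ddot Y+2n^{-1}\kappa^{-1/2}\dot Y+2n^{-2}\kappa^{-1}\nabla f(\hat Y)=0,$$ where $\hat Y$ is a delayed version of $Y$ with delay bounded by $\tau$. Let $\eta=n\kappa^{1/2}$, $c_0=6\kappa^2\eta^{-1}\tau^2$ and $r=\eta^{-1}$. If $\tau\le\frac{1}{\sqrt{48}}n\kappa^{-1/2}$, then $$e^{-\eta^{-1}t}\frac{d}{dt}\left(E(t)+e^{\eta^{-1}t}A(t)\right)\le0,$$ where $$E(t)=e^{n^{-1}\kappa^{-1/2}t}\left(f(Y(t))+\tfrac14\|Y(t)+\eta\dot Y(t)\|^2\right),\qquad A(t)=\int_{t-\tau}^tc(t-s)\|\dot Y(s)\|^2ds,$$ $$c(t)=c_0\left(e^{-rt}+\frac{e^{-r\tau}}{1-e^{-r\tau}}\left(e^{-rt}-1\right)\right).$$ Hence $f(Y(t))$ converges linearly to $f(x_* )$ with rate $\mathcal{O}\left(\exp(-tn^{-1}\kappa^{-1/2})\right)$.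
   Context: $f:\mathbb{R}^d\to\mathbb{R}$ is strongly convex with modulus $\sigma=1$ (after rescaling $f$) and has $L$-Lipschitz gradient, with variables split into $n$ coordinate blocks whose block Lipschitz constants satisfy $L_i=L$ for all $i$; $\kappa=L/\sigma=L$. The minimizer and minimum value are normalized: $x_*=0$, $f(x_* )=0$. The delayed version $\hat Y(t)$ of $Y(t)$ is the vector whose $i$-th block is the $i$-th block of $Y(t-j(t,i))$, with delays $0\le j(t,i)\le\tau$, $\tau>0$ ($Y$ being defined and differentiable on a time interval that includes the past times involved). *)

theory Defs
  imports "HOL-Analysis.Analysis" "HOL-Library.Landau_Symbols"
begin

definition strongly_convex_on :: "'a::real_normed_vector set \<Rightarrow> real \<Rightarrow> ('a \<Rightarrow> real) \<Rightarrow> bool"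
  where "strongly_convex_on S \<sigma> f \<longleftrightarrow> convex S \<and> (\<forall>x\<in>S. \<forall>y\<in>S. \<forall>u\<in>{0..1}.
    f (u *\<^sub>R x + (1 - u) *\<^sub>R y)
      \<le> u * f x + (1 - u) * f y - \<sigma> / 2 * u * (1 - u) * (norm (x - y))\<^sup>2)"

text \<open>A splitting of the coordinates into blocks is a map \<open>blk\<close> sending each coordinate to the
  number of its block. The \<open>i\<close>-th block of a vector is represented inside the full space, with
  zeros in the coordinates outside the block; this does not change its Euclidean norm.\<close>

definition block :: "('d \<Rightarrow> nat) \<Rightarrow> nat \<Rightarrow> real ^ 'd \<Rightarrow> real ^ 'd"
  where "block blk i x = (\<chi> k. if blk k = i then x $ k else 0)"

definition block_lipschitz ::
    "('d::finite \<Rightarrow> nat) \<Rightarrow> nat \<Rightarrow> real \<Rightarrow> (real ^ 'd \<Rightarrow> real ^ 'd) \<Rightarrow> bool"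
  where "block_lipschitz blk i K g \<longleftrightarrow>
    (\<forall>x. K-lipschitz_on (range (block blk i)) (\<lambda>h. block blk i (g (x + h))))"

definition delayed ::
    "('d \<Rightarrow> nat) \<Rightarrow> (real \<Rightarrow> nat \<Rightarrow> real) \<Rightarrow> (real \<Rightarrow> real ^ 'd) \<Rightarrow> real \<Rightarrow> real ^ 'd"
  where "delayed blk j Y t = (\<chi> k. Y (t - j t (blk k)) $ k)"

end

theory Submission
  imports Defs
begin

text \<open>
  Write \<open>r = 1 / \<eta>\<close>; in this notation the equation is
  \<open>Y'' + 2 r Y' + 2 r\<^sup>2 \<nabla>f(Y\<^sub>d) = 0\<close> with \<open>Y\<^sub>d\<close> the delayed state. Differentiating the energy and
  inserting the equation leaves, up to the factor \<open>e\<^bsup>rt\<^esup>\<close>, the term \<open>r (f(Y) - \<langle>\<nabla>f(Y), Y\<rangle>)\<close> and terms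
  in \<open>Y\<close>, \<open>Y'\<close> and the gradient error \<open>d = \<nabla>f(Y) - \<nabla>f(Y\<^sub>d)\<close>. Strong convexity bounds \<open>f(Y)\<close> from above by
  \<open>\<langle>\<nabla>f(Y), Y\<rangle> - |Y|\<^sup>2 / 2\<close>, and completing two squares gives
  \<open>e\<^bsup>-rt\<^esup> E' \<le> 3 r |d|\<^sup>2 - (\<eta> / 8) |Y'|\<^sup>2\<close> (\<open>energy_dissipation\<close>).

  The error is an effect of the delay: each coordinate of \<open>Y - Y\<^sub>d\<close> is an integral of a velocity
  coordinate over a time at most \<open>\<tau>\<close>, so by Cauchy-Schwarz
  \<open>|d|\<^sup>2 \<le> \<kappa>\<^sup>2 \<tau> I\<close>, where \<open>I\<close> is the integral of \<open>|Y'|\<^sup>2\<close> over the last \<open>\<tau>\<close> time units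
  (\<open>delayed_displacement_le\<close>).

  The memory term \<open>A\<close> pays for this. Its kernel has the form \<open>c(u) = \<alpha> e\<^bsup>-ru\<^esup> + \<beta>\<close>, which makes
  \<open>r c + c' = r \<beta>\<close> constant, and \<open>c(\<tau>) = 0\<close>, which removes the velocity at time \<open>t - \<tau>\<close> from
  the derivative. Hence \<open>e\<^bsup>-rt\<^esup> (e\<^bsup>rt\<^esup> A)' = c\<^sub>0 |Y'|\<^sup>2 - r c\<^sub>0 q I\<close> with
  \<open>q = e\<^bsup>-r\<tau>\<^esup> / (1 - e\<^bsup>-r\<tau>\<^esup>)\<close> (\<open>exponential_window_deriv\<close>). The bound on \<open>\<tau>\<close> is exactly
  \<open>c\<^sub>0 \<le> \<eta> / 8\<close>, and since a strongly convex function with modulus 1 has \<open>\<kappa> \<ge> 1\<close>, it also forces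
  \<open>r \<tau> \<le> 1\<close>, where \<open>2 r \<tau> q \<ge> 1\<close>, that is \<open>3 r \<kappa>\<^sup>2 \<tau> \<le> r c\<^sub>0 q\<close>. So the total is nonpositive.
  The sum is therefore bounded by its initial value, and both \<open>A\<close> and the kinetic part of \<open>E\<close> are
  nonnegative, which leaves \<open>e\<^bsup>rt\<^esup> f(Y)\<close> bounded.

  The one analytic subtlety is that on the initial history the squared velocity is merely
  integrable, so the integral over the moving window need not be differentiable at its lower end.
  That \<open>c\<close> vanishes at \<open>\<tau>\<close> repairs this as well (\<open>vanishing_kernel_integral_deriv\<close>).
\<close>

section \<open>Gradients of strongly convex functions\<close>

lemma gderiv_along_curve:
  assumes curve: "(\<gamma> has_vector_derivative v) (at t within S)" and grad: "GDERIV f (\<gamma> t) :> p"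
  shows "((\<lambda>s. f (\<gamma> s)) has_real_derivative inner v p) (at t within S)"
proof -
  have "(f has_derivative (\<lambda>h. inner h p)) (at (\<gamma> t) within \<gamma> ` S)"
    using grad unfolding gderiv_def by (rule has_derivative_at_withinI)
  with curve[unfolded has_vector_derivative_def]
  have "((\<lambda>s. f (\<gamma> s)) has_derivative (\<lambda>h. inner (h *\<^sub>R v) p)) (at t within S)"
    by (rule has_derivative_in_compose)
  then show ?thesis
    by (simp add: has_field_derivative_def mult_commute_abs)
qed

text \<open>The convexity inequality on the segment from \<open>x\<close> to \<open>y\<close> bounds the difference quotient of \<open>f\<close>
  at \<open>x\<close> in the direction \<open>y - x\<close>; its limit at \<open>x\<close> is the claim.\<close>

lemma strongly_convex_gradient_ineq:
  fixes f :: "'a::real_inner \<Rightarrow> real"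
  assumes strong: "strongly_convex_on UNIV \<sigma> f" and grad: "GDERIV f x :> p"
  shows "f x + inner (y - x) p + \<sigma> / 2 * (norm (y - x))\<^sup>2 \<le> f y"
proof -
  define \<phi> where "\<phi> u = f (x + u *\<^sub>R (y - x))" for u :: real
  have "((\<lambda>u. x + u *\<^sub>R (y - x)) has_vector_derivative y - x) (at 0 within {0<..})"
    by (auto intro!: derivative_eq_intros)
  then have "(\<phi> has_real_derivative inner (y - x) p) (at 0 within {0<..})"
    unfolding \<phi>_def using grad by (intro gderiv_along_curve) auto
  then have slope: "((\<lambda>u. (\<phi> u - \<phi> 0) / (u - 0)) \<longlongrightarrow> inner (y - x) p) (at_right 0)"
    by (simp add: has_field_derivative_iff)
  have "((\<lambda>u. f y - f x - \<sigma> / 2 * (1 - u) * (norm (y - x))\<^sup>2) \<longlongrightarrow>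
      f y - f x - \<sigma> / 2 * (1 - 0) * (norm (y - x))\<^sup>2) (at_right 0)"
    by (intro tendsto_intros)
  moreover have "\<forall>\<^sub>F u :: real in at_right 0. u \<in> {0<..<1}"
    by (rule eventually_at_right_real) simp
  then have "\<forall>\<^sub>F u in at_right 0. (\<phi> u - \<phi> 0) / (u - 0)
      \<le> f y - f x - \<sigma> / 2 * (1 - u) * (norm (y - x))\<^sup>2"
  proof eventually_elim
    case (elim u)
    have "u *\<^sub>R y + (1 - u) *\<^sub>R x = x + u *\<^sub>R (y - x)"
      by (simp add: algebra_simps)
    then have "\<phi> u \<le> u * f y + (1 - u) * f x - \<sigma> / 2 * u * (1 - u) * (norm (y - x))\<^sup>2"
      using strong elim unfolding strongly_convex_on_def \<phi>_def
      by (metis UNIV_I atLeastAtMost_iff greaterThanLessThan_iff less_imp_le)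
    then have "\<phi> u - \<phi> 0 \<le> u * (f y - f x - \<sigma> / 2 * (1 - u) * (norm (y - x))\<^sup>2)"
      by (simp add: \<phi>_def algebra_simps)
    then show ?case
      using elim by (simp add: divide_le_eq mult.commute)
  qed
  ultimately have "inner (y - x) p \<le> f y - f x - \<sigma> / 2 * (1 - 0) * (norm (y - x))\<^sup>2"
    using slope by (intro tendsto_le[OF _ _ slope]) auto
  then show ?thesis by simp
qed

text \<open>Adding the gradient inequalities at two points shows that the gradient is strongly monotone
  with modulus \<open>\<sigma>\<close>, and a strongly monotone map cannot have a smaller Lipschitz constant. This is
  where \<open>\<kappa> \<ge> 1\<close> comes from.\<close>

lemma strongly_convex_lipschitz_ge:
  fixes f :: "'a::euclidean_space \<Rightarrow> real"
  assumes grad: "\<And>x. GDERIV f x :> gradf x" and strong: "strongly_convex_on UNIV \<sigma> f"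
    and lip: "L-lipschitz_on UNIV gradf"
  shows "\<sigma> \<le> L"
proof -
  obtain b :: 'a where b: "norm b = 1"
    using nonempty_Basis norm_Basis by blast
  have "\<sigma> * (norm b)\<^sup>2 \<le> inner b (gradf b - gradf 0)"
    using strongly_convex_gradient_ineq[OF strong grad[of 0], of b]
      strongly_convex_gradient_ineq[OF strong grad[of b], of 0]
    by (simp add: inner_diff_right)
  also have "\<dots> \<le> norm b * norm (gradf b - gradf 0)"
    by (rule norm_cauchy_schwarz)
  also have "\<dots> \<le> norm b * (L * norm (b - 0))"
    using lipschitz_onD[OF lip, of b 0] by (intro mult_left_mono) (auto simp: dist_norm)
  finally show ?thesis by (simp add: b)
qed

section \<open>Displacement caused by the delay\<close>

text \<open>Cauchy-Schwarz against the constant function, obtained by integrating \<open>(h - m)\<^sup>2 \<ge> 0\<close> for the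
  mean value \<open>m\<close> of \<open>h\<close>.\<close>

lemma square_integral_le:
  fixes h :: "real \<Rightarrow> real"
  assumes "a \<le> b" and h: "h integrable_on {a..b}" and h2: "(\<lambda>s. (h s)\<^sup>2) integrable_on {a..b}"
  shows "(integral {a..b} h)\<^sup>2 \<le> (b - a) * integral {a..b} (\<lambda>s. (h s)\<^sup>2)"
proof (cases "a = b")
  case False
  define m where "m = integral {a..b} h / (b - a)"
  have "((\<lambda>s. (h s)\<^sup>2 - (2 * m) * h s + m\<^sup>2) has_integral
      integral {a..b} (\<lambda>s. (h s)\<^sup>2) - 2 * m * integral {a..b} h + (b - a) *\<^sub>R m\<^sup>2) {a..b}"
    using h h2 has_integral_const_real[of "m\<^sup>2" a b] \<open>a \<le> b\<close>
    by (intro has_integral_add has_integral_diff has_integral_mult_right integrable_integral) auto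
  moreover have "0 \<le> (h s)\<^sup>2 - (2 * m) * h s + m\<^sup>2" for s
    using zero_le_power2[of "h s - m"] by (simp add: power2_eq_square algebra_simps)
  ultimately have "0 \<le> integral {a..b} (\<lambda>s. (h s)\<^sup>2) - 2 * m * integral {a..b} h + (b - a) *\<^sub>R m\<^sup>2"
    by (rule has_integral_nonneg)
  also have "\<dots> = integral {a..b} (\<lambda>s. (h s)\<^sup>2) - (integral {a..b} h)\<^sup>2 / (b - a)"
    using False \<open>a \<le> b\<close> by (simp add: m_def power2_eq_square)
  finally show ?thesis
    using False \<open>a \<le> b\<close> by (simp add: divide_le_eq mult.commute)
qed simp

text \<open>The blocks have different delays, so there is no single interval on which to compare \<open>Y\<close> with
  its delayed version. Cauchy-Schwarz is applied to every coordinate separately; the squared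
  velocity coordinates then add up to the squared norm on the longest interval, and the bound
  does not depend on the number of blocks.\<close>

lemma delayed_displacement_le:
  fixes Y dY :: "real \<Rightarrow> real ^ 'd"
  assumes deriv: "\<And>s. s \<in> {t - \<tau>..t} \<Longrightarrow> (Y has_vector_derivative dY s) (at s within {t - \<tau>..t})"
    and int: "(\<lambda>s. (norm (dY s))\<^sup>2) integrable_on {t - \<tau>..t}"
    and delay: "\<And>k. 0 \<le> j t (blk k) \<and> j t (blk k) \<le> \<tau>"
  shows "(norm (Y t - delayed blk j Y t))\<^sup>2 \<le> \<tau> * integral {t - \<tau>..t} (\<lambda>s. (norm (dY s))\<^sup>2)"
proof -
  let ?I = "{t - \<tau>..t}"
  have \<tau>: "0 \<le> \<tau>" using delay[of undefined] by linarith
  have ftc: "((\<lambda>s. dY s $ k) has_integral (Y b $ k - Y a $ k)) {a..b}"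
    if "a \<le> b" "{a..b} \<subseteq> ?I" for a b k
  proof (rule fundamental_theorem_of_calculus[OF \<open>a \<le> b\<close>])
    fix s assume "s \<in> {a..b}"
    then have "(Y has_vector_derivative dY s) (at s within {a..b})"
      using deriv[of s] that(2) has_vector_derivative_within_subset by blast
    then show "((\<lambda>s. Y s $ k) has_vector_derivative dY s $ k) (at s within {a..b})"
      by (rule bounded_linear.has_vector_derivative[OF bounded_linear_vec_nth])
  qed
  \<comment> \<open>\<open>dY\<close> is a derivative, hence measurable, so integrability of the norm passes to coordinates.\<close>
  have sq: "(\<lambda>s. (dY s $ k)\<^sup>2) integrable_on ?I" for k
  proof (rule measurable_bounded_by_integrable_imp_integrable_real[OF _ int])
    have "(\<lambda>s. dY s $ k) integrable_on ?I" using ftc[of "t - \<tau>" t k] \<tau> by auto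
    then have "(\<lambda>s. dY s $ k) \<in> borel_measurable (lebesgue_on ?I)"
      by (rule integrable_imp_measurable)
    then show "(\<lambda>s. (dY s $ k)\<^sup>2) \<in> borel_measurable (lebesgue_on ?I)"
      by measurable
    show "\<bar>(dY s $ k)\<^sup>2\<bar> \<le> (norm (dY s))\<^sup>2" if "s \<in> ?I" for s
      using power_mono[OF component_le_norm_cart[of "dY s" k], of 2] by simp
  qed auto
  have comp: "((Y t - delayed blk j Y t) $ k)\<^sup>2 \<le> \<tau> * integral ?I (\<lambda>s. (dY s $ k)\<^sup>2)" for k
  proof -
    define d where "d = j t (blk k)"
    have d: "0 \<le> d" "d \<le> \<tau>" using delay by (auto simp: d_def)
    then have sub: "{t - d..t} \<subseteq> ?I" by auto
    have sqd: "(\<lambda>s. (dY s $ k)\<^sup>2) integrable_on {t - d..t}"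
      using sq sub by (rule integrable_on_subinterval)
    have I: "((\<lambda>s. dY s $ k) has_integral ((Y t - delayed blk j Y t) $ k)) {t - d..t}"
      using ftc[OF _ sub, of k] d by (simp add: delayed_def d_def)
    have "((Y t - delayed blk j Y t) $ k)\<^sup>2 = (integral {t - d..t} (\<lambda>s. dY s $ k))\<^sup>2"
      using I by (simp add: integral_unique)
    also have "\<dots> \<le> (t - (t - d)) * integral {t - d..t} (\<lambda>s. (dY s $ k)\<^sup>2)"
      using I sqd d by (intro square_integral_le) auto
    also have "\<dots> \<le> \<tau> * integral ?I (\<lambda>s. (dY s $ k)\<^sup>2)"
      using d \<tau> integral_subset_le[OF sub sqd sq] integral_nonneg[OF sqd]
      by (intro mult_mono) auto
    finally show ?thesis .
  qed
  have n2: "(norm x)\<^sup>2 = (\<Sum>k\<in>UNIV. (x $ k)\<^sup>2)" for x :: "real ^ 'd"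
    by (simp add: norm_vec_def L2_set_def sum_nonneg)
  have "(norm (Y t - delayed blk j Y t))\<^sup>2 \<le> (\<Sum>k\<in>UNIV. \<tau> * integral ?I (\<lambda>s. (dY s $ k)\<^sup>2))"
    unfolding n2 by (rule sum_mono) (rule comp)
  also have "\<dots> = \<tau> * integral ?I (\<lambda>s. (norm (dY s))\<^sup>2)"
    unfolding n2 by (simp add: integral_sum sq sum_distrib_left)
  finally show ?thesis .
qed

section \<open>Differentiating the memory term\<close>

text \<open>If \<open>g\<close> were continuous, this would be the Leibniz rule with a boundary term
  \<open>(\<phi> v - \<phi> v) g v = 0\<close>. For \<open>g\<close> merely integrable the boundary term still disappears: between
  \<open>v\<close> and \<open>w\<close> the kernel is at most \<open>|\<phi> w - \<phi> v|\<close>, of the order of \<open>w - v\<close>, and it is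
  integrated against the small mass that \<open>g\<close> has there.\<close>

lemma vanishing_kernel_integral_deriv:
  fixes g \<phi> :: "real \<Rightarrow> real"
  assumes int: "\<And>T. g integrable_on {a..T}" "\<And>T. (\<lambda>s. \<phi> s * g s) integrable_on {a..T}"
    and nonneg: "\<And>s. a \<le> s \<Longrightarrow> 0 \<le> g s"
    and mono: "mono \<phi>" and deriv: "(\<phi> has_real_derivative \<phi>') (at v within {a..})"
    and "a \<le> v"
  shows "((\<lambda>w. integral {a..w} (\<lambda>s. (\<phi> s - \<phi> w) * g s)) has_real_derivative
      - \<phi>' * integral {a..v} g) (at v within {a..})"
proof -
  define G where "G w = integral {a..w} g" for w
  define F where "F w = integral {a..w} (\<lambda>s. (\<phi> s - \<phi> w) * g s)" for w
  have int': "(\<lambda>s. (\<phi> s - x) * g s) integrable_on {b..T}" if "a \<le> b" for b T x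
  proof -
    have "(\<lambda>s. \<phi> s * g s - x * g s) integrable_on {b..T}"
      using that int[THEN integrable_on_subinterval, of b T T]
      by (intro integrable_diff integrable_on_mult_right) auto
    then show ?thesis by (simp add: left_diff_distrib)
  qed
  have intg: "g integrable_on {b..T}" if "a \<le> b" for b T
    by (rule integrable_on_subinterval[OF int(1)[of T]]) (use that in auto)
  have split: "F w - F z + (\<phi> w - \<phi> z) * G z = integral {z..w} (\<lambda>s. (\<phi> s - \<phi> w) * g s)"
    if "a \<le> z" "z \<le> w" for z w
  proof -
    have "F w = integral {a..z} (\<lambda>s. (\<phi> s - \<phi> w) * g s) + integral {z..w} (\<lambda>s. (\<phi> s - \<phi> w) * g s)"
      unfolding F_def using Henstock_Kurzweil_Integration.integral_combine[OF that int'] by simp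
    moreover have "integral {a..z} (\<lambda>s. (\<phi> s - \<phi> w) * g s)
        = integral {a..z} (\<lambda>s. (\<phi> s - \<phi> z) * g s - (\<phi> w - \<phi> z) * g s)"
      by (simp add: algebra_simps)
    moreover have "\<dots> = F z - (\<phi> w - \<phi> z) * G z"
      unfolding F_def G_def using int'[of a "\<phi> z" z] int(1)[of z]
      by (subst integral_diff) (auto intro: integrable_on_mult_right)
    ultimately show ?thesis by simp
  qed
  have split': "G w - G z = integral {z..w} g" if "a \<le> z" "z \<le> w" for z w
    unfolding G_def using Henstock_Kurzweil_Integration.integral_combine[OF that int(1)] by simp
  \<comment> \<open>The boundary contribution, estimated by monotonicity of the kernel.\<close>
  have small: "0 \<le> - integral {z..w} (\<lambda>s. (\<phi> s - \<phi> w) * g s)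
      \<and> - integral {z..w} (\<lambda>s. (\<phi> s - \<phi> w) * g s) \<le> (\<phi> w - \<phi> z) * (G w - G z)"
    if zw: "a \<le> z" "z \<le> w" for z w
  proof -
    have i: "(\<lambda>s. (\<phi> w - \<phi> s) * g s) integrable_on {z..w}"
      using integrable_neg[OF int'[OF zw(1), of "\<phi> w" w]] by (simp add: algebra_simps)
    have e: "- integral {z..w} (\<lambda>s. (\<phi> s - \<phi> w) * g s) = integral {z..w} (\<lambda>s. (\<phi> w - \<phi> s) * g s)"
      by (simp flip: integral_neg add: algebra_simps)
    have "integral {z..w} (\<lambda>s. (\<phi> w - \<phi> s) * g s) \<le> integral {z..w} (\<lambda>s. (\<phi> w - \<phi> z) * g s)"
      using zw nonneg mono i intg[OF zw(1)]
      by (intro integral_le integrable_on_mult_right) (auto intro!: mult_right_mono dest: monoD)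
    moreover have "0 \<le> integral {z..w} (\<lambda>s. (\<phi> w - \<phi> s) * g s)"
      using zw nonneg mono i by (intro integral_nonneg) (auto intro!: mult_nonneg_nonneg dest: monoD)
    ultimately show ?thesis
      by (simp add: e split'[OF zw])
  qed
  \<comment> \<open>For \<open>w < v\<close> exchanging the two points replaces \<open>G v\<close> by \<open>G w\<close>; the correction has the same size.\<close>
  have rem: "\<bar>F w - F v + (\<phi> w - \<phi> v) * G v\<bar> \<le> \<bar>\<phi> w - \<phi> v\<bar> * \<bar>G w - G v\<bar>" if "a \<le> w" for w
  proof (cases "v \<le> w")
    case True
    with \<open>a \<le> v\<close> show ?thesis
      unfolding split[OF \<open>a \<le> v\<close> True] using small[of v w] by (simp flip: abs_mult)
  next
    case False
    then have "w \<le> v" by simp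
    have "F w - F v + (\<phi> w - \<phi> v) * G v
        = - (F v - F w + (\<phi> v - \<phi> w) * G w) - (\<phi> v - \<phi> w) * (G v - G w)"
      by (simp add: algebra_simps)
    then show ?thesis
      unfolding split[OF that \<open>w \<le> v\<close>] using small[OF that \<open>w \<le> v\<close>]
      by (simp add: abs_minus_commute[of "\<phi> w"] abs_minus_commute[of "G w"] flip: abs_mult)
  qed
  have "continuous_on {a..v+1} G"
    unfolding G_def using int(1) by (rule indefinite_integral_continuous_1)
  then have "(G \<longlongrightarrow> G v) (at v within {a..v+1})"
    using \<open>a \<le> v\<close> by (auto simp: continuous_on_def)
  moreover have near: "at v within {a..v+1} = at v within {a..}"
    by (rule at_within_nhd[of _ "{..<v+1}"]) auto
  ultimately have G0: "((\<lambda>w. \<bar>G w - G v\<bar>) \<longlongrightarrow> 0) (at v within {a..})"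
    by (auto intro!: tendsto_rabs_zero simp: LIM_zero_iff)
  have \<phi>q: "((\<lambda>w. (\<phi> w - \<phi> v) / (w - v)) \<longlongrightarrow> \<phi>') (at v within {a..})"
    using deriv by (simp add: has_field_derivative_iff)
  let ?q = "\<lambda>w. (F w - F v) / (w - v) + (\<phi> w - \<phi> v) / (w - v) * G v"
  have "(?q \<longlongrightarrow> 0) (at v within {a..})"
  proof (rule Lim_null_comparison)
    show "\<forall>\<^sub>F w in at v within {a..}. norm (?q w) \<le> \<bar>(\<phi> w - \<phi> v) / (w - v)\<bar> * \<bar>G w - G v\<bar>"
      unfolding eventually_at_filter
    proof (intro always_eventually allI impI)
      fix w assume "w \<noteq> v" "w \<in> {a..}"
      have "?q w = (F w - F v + (\<phi> w - \<phi> v) * G v) / (w - v)"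
        by (simp add: add_divide_distrib)
      then show "norm (?q w) \<le> \<bar>(\<phi> w - \<phi> v) / (w - v)\<bar> * \<bar>G w - G v\<bar>"
        using rem[of w] \<open>w \<in> {a..}\<close> by (simp add: abs_divide divide_right_mono)
    qed
    show "((\<lambda>w. \<bar>(\<phi> w - \<phi> v) / (w - v)\<bar> * \<bar>G w - G v\<bar>) \<longlongrightarrow> 0) (at v within {a..})"
      using tendsto_mult[OF tendsto_rabs[OF \<phi>q] G0] by simp
  qed
  from tendsto_diff[OF this tendsto_mult_right[OF \<phi>q, of "G v"]]
  have "((\<lambda>w. (F w - F v) / (w - v)) \<longlongrightarrow> - \<phi>' * G v) (at v within {a..})"
    by simp
  then show ?thesis
    unfolding has_field_derivative_iff F_def G_def .
qed

lemma exp_times_integrable: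
  fixes g :: "real \<Rightarrow> real"
  assumes int: "g integrable_on {a..b}" and nonneg: "\<And>s. a \<le> s \<Longrightarrow> 0 \<le> g s" and "0 \<le> r"
  shows "(\<lambda>s. exp (r * s) * g s) integrable_on {a..b}"
proof (rule measurable_bounded_by_integrable_imp_integrable_real)
  have "g \<in> borel_measurable (lebesgue_on {a..b})"
    using int by (rule integrable_imp_measurable)
  moreover have "(\<lambda>s. exp (r * s)) \<in> borel_measurable (lebesgue_on {a..b})"
    by (intro continuous_imp_measurable_on_sets_lebesgue continuous_intros) simp
  ultimately show "(\<lambda>s. exp (r * s) * g s) \<in> borel_measurable (lebesgue_on {a..b})"
    by (rule borel_measurable_times[rotated])
  show "(\<lambda>s. exp (r * b) * g s) integrable_on {a..b}"
    using int by (rule integrable_on_mult_right)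
  show "\<bar>exp (r * s) * g s\<bar> \<le> exp (r * b) * g s" if "s \<in> {a..b}" for s
    using that nonneg \<open>0 \<le> r\<close> by (auto simp: abs_mult intro!: mult_right_mono mult_left_mono)
qed simp

text \<open>The assumption on \<open>\<alpha>\<close> and \<open>\<beta>\<close> says that the kernel vanishes at \<open>\<tau>\<close>. After multiplication by
  \<open>e\<^bsup>ru\<^esup>\<close> the integrand is \<open>\<alpha> (e\<^bsup>rs\<^esup> - e\<^bsup>ru\<^esup>) + (\<alpha> + \<beta>) e\<^bsup>ru\<^esup>\<close>, and also
  \<open>\<alpha> (e\<^bsup>rs\<^esup> - e\<^bsup>r(u-\<tau>)\<^esup>)\<close>, times \<open>g s\<close>. With the first form up to \<open>u\<close> and the second up to
  \<open>u - \<tau>\<close>, everything reduces to the preceding rule and to the primitive of \<open>g\<close>, which is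
  differentiated only at times \<open>t \<ge> t0\<close>, where \<open>g\<close> is continuous.\<close>

lemma exponential_window_deriv:
  fixes g :: "real \<Rightarrow> real"
  assumes int: "\<And>T. g integrable_on {t0 - \<tau>..T}" and nonneg: "\<And>s. 0 \<le> g s"
    and cont: "continuous_on {t0..} g"
    and "0 < \<tau>" "0 < r" and vanish: "\<alpha> * exp (- r * \<tau>) + \<beta> = 0" and "t0 \<le> t"
  shows "((\<lambda>u. exp (r * u) * integral {u - \<tau>..u} (\<lambda>s. (\<alpha> * exp (- r * (u - s)) + \<beta>) * g s))
      has_real_derivative
      exp (r * t) * ((\<alpha> + \<beta>) * g t + \<beta> * r * integral {t - \<tau>..t} g)) (at t within {t0..})"
proof -
  define a where "a = t0 - \<tau>"
  define \<phi> where "\<phi> s = exp (r * s)" for s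
  define G where "G w = integral {a..w} g" for w
  define F where "F w = integral {a..w} (\<lambda>s. (\<phi> s - \<phi> w) * g s)" for w
  have int: "g integrable_on {a..T}" for T
    using int by (simp add: a_def)
  have int\<phi>: "(\<lambda>s. \<phi> s * g s) integrable_on {a..T}" for T
    unfolding \<phi>_def using int nonneg \<open>0 < r\<close> by (intro exp_times_integrable) auto
  have int_lin: "(\<lambda>s. (x * \<phi> s + y) * g s) integrable_on {a..T}" for x y T
    using integrable_add[OF integrable_on_mult_right[OF int\<phi>, of x] integrable_on_mult_right[OF int, of y]]
    by (simp add: algebra_simps)
  have lin: "integral {a..w} (\<lambda>s. (x * \<phi> s + y) * g s) = x * F w + (x * \<phi> w + y) * G w" for x y w
  proof -
    have "F w = integral {a..w} (\<lambda>s. \<phi> s * g s) - \<phi> w * G w"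
      unfolding F_def G_def left_diff_distrib
      by (simp add: integral_diff int\<phi> integrable_on_mult_right int)
    moreover have "integral {a..w} (\<lambda>s. (x * \<phi> s + y) * g s)
        = x * integral {a..w} (\<lambda>s. \<phi> s * g s) + y * G w"
      unfolding G_def distrib_right mult.assoc
      by (simp add: integral_add int\<phi> integrable_on_mult_right int)
    ultimately show ?thesis by algebra
  qed
  have shift: "\<phi> (u - \<tau>) = \<phi> u * exp (- r * \<tau>)" for u
    by (simp add: \<phi>_def algebra_simps flip: exp_add)
  have \<beta>: "\<beta> * \<phi> u = - \<alpha> * \<phi> (u - \<tau>)" for u
    using vanish unfolding shift by (simp add: eq_neg_iff_add_eq_0) algebra
  have window: "exp (r * u) * integral {u - \<tau>..u} (\<lambda>s. (\<alpha> * exp (- r * (u - s)) + \<beta>) * g s)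
      = \<alpha> * F u + (\<alpha> + \<beta>) * \<phi> u * G u - \<alpha> * F (u - \<tau>)" if "t0 \<le> u" for u
  proof -
    let ?h = "\<lambda>s. (\<alpha> * \<phi> s + \<beta> * \<phi> u) * g s"
    have "exp (r * u) * exp (- r * (u - s)) = \<phi> s" for s
      by (simp add: \<phi>_def algebra_simps flip: exp_add)
    then have "exp (r * u) * ((\<alpha> * exp (- r * (u - s)) + \<beta>) * g s) = ?h s" for s
      by (simp add: \<phi>_def[of u] algebra_simps) (metis mult.assoc mult.commute)
    then have "exp (r * u) * integral {u - \<tau>..u} (\<lambda>s. (\<alpha> * exp (- r * (u - s)) + \<beta>) * g s)
        = integral {u - \<tau>..u} ?h"
      by (subst integral_mult_right[symmetric]) (simp only:)
    also have "\<dots> = integral {a..u} ?h - integral {a..u - \<tau>} ?h"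
      using Henstock_Kurzweil_Integration.integral_combine[OF _ _ int_lin, of "u - \<tau>" u \<alpha> "\<beta> * \<phi> u"]
        that \<open>0 < \<tau>\<close> by (simp add: a_def)
    finally show ?thesis
      unfolding lin using \<beta>[of u] by algebra
  qed
  have d\<phi>: "(\<phi> has_real_derivative r * \<phi> w) (at w within X)" for w X
    unfolding \<phi>_def by (auto intro!: derivative_eq_intros)
  have "mono \<phi>"
    using \<open>0 < r\<close> by (auto simp: \<phi>_def mono_def)
  then have dF: "(F has_real_derivative - (r * \<phi> w) * G w) (at w within {a..})" if "a \<le> w" for w
    unfolding F_def G_def using int int\<phi> nonneg d\<phi> that
    by (intro vanishing_kernel_integral_deriv) auto
  have dFt: "(F has_real_derivative - (r * \<phi> t) * G t) (at t within {t0..})"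
    using dF[of t] \<open>t0 \<le> t\<close> \<open>0 < \<tau>\<close> by (intro DERIV_subset[OF dF]) (auto simp: a_def)
  have "((F \<circ> (\<lambda>u. u - \<tau>)) has_real_derivative - (r * \<phi> (t - \<tau>)) * G (t - \<tau>) * 1) (at t within {t0..})"
  proof (rule DERIV_image_chain)
    show "(F has_real_derivative - (r * \<phi> (t - \<tau>)) * G (t - \<tau>)) (at (t - \<tau>) within (\<lambda>u. u - \<tau>) ` {t0..})"
      using \<open>t0 \<le> t\<close> by (intro DERIV_subset[OF dF]) (auto simp: a_def)
  qed (auto intro!: derivative_eq_intros)
  then have dF\<tau>: "((\<lambda>u. F (u - \<tau>)) has_real_derivative - (r * \<phi> (t - \<tau>)) * G (t - \<tau>)) (at t within {t0..})"
    by (simp add: o_def)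
  have "((\<lambda>u. G t0 + integral {t0..u} g) has_real_derivative g t) (at t within {t0..t + 1})"
    using integral_has_real_derivative[of t0 "t + 1" g t] continuous_on_subset[OF cont, of "{t0..t + 1}"] \<open>t0 \<le> t\<close>
    by (auto intro!: derivative_eq_intros)
  moreover have "G t0 + integral {t0..u} g = G u" if "t0 \<le> u" for u
    unfolding G_def using that \<open>0 < \<tau>\<close>
    by (intro Henstock_Kurzweil_Integration.integral_combine int) (auto simp: a_def)
  ultimately have "(G has_real_derivative g t) (at t within {t0..t + 1})"
    using \<open>t0 \<le> t\<close> by (elim has_field_derivative_transform_within[where d = 1]) auto
  moreover have "at t within {t0..t + 1} = at t within {t0..}"
    by (rule at_within_nhd[of _ "{..<t+1}"]) auto
  ultimately have dG: "(G has_real_derivative g t) (at t within {t0..})"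
    by simp
  have G_diff: "integral {t - \<tau>..t} g = G t - G (t - \<tau>)"
    unfolding G_def
    using Henstock_Kurzweil_Integration.integral_combine[OF _ _ int, of "t - \<tau>" t] \<open>t0 \<le> t\<close> \<open>0 < \<tau>\<close>
    by (simp add: a_def)
  have "((\<lambda>u. \<alpha> * F u + (\<alpha> + \<beta>) * \<phi> u * G u - \<alpha> * F (u - \<tau>)) has_real_derivative
      \<alpha> * (- (r * \<phi> t) * G t) + ((\<alpha> + \<beta>) * (r * \<phi> t) * G t + (\<alpha> + \<beta>) * \<phi> t * g t)
        - \<alpha> * (- (r * \<phi> (t - \<tau>)) * G (t - \<tau>))) (at t within {t0..})"
    by (auto intro!: derivative_eq_intros dFt dF\<tau> dG d\<phi>)
  also have "\<alpha> * (- (r * \<phi> t) * G t) + ((\<alpha> + \<beta>) * (r * \<phi> t) * G t + (\<alpha> + \<beta>) * \<phi> t * g t)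
        - \<alpha> * (- (r * \<phi> (t - \<tau>)) * G (t - \<tau>))
      = \<phi> t * ((\<alpha> + \<beta>) * g t + \<beta> * r * (G t - G (t - \<tau>)))"
    using \<beta>[of t] by algebra
  finally show ?thesis
    unfolding G_diff \<phi>_def[of t]
    using \<open>t0 \<le> t\<close> by (elim has_field_derivative_transform_within[where d = 1]) (simp_all only: window atLeast_iff zero_less_one)
qed

section \<open>Dissipation of the energy\<close>

lemma energy_deriv:
  fixes Y dY :: "real \<Rightarrow> 'a::real_inner"
  assumes Y: "(Y has_vector_derivative dY t) (at t within S)"
    and dY: "(dY has_vector_derivative a) (at t within S)"
    and grad: "GDERIV f (Y t) :> p"
  shows "((\<lambda>u. exp (r * u) * (f (Y u) + 1/4 * (norm (Y u + \<eta> *\<^sub>R dY u))\<^sup>2)) has_real_derivative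
      exp (r * t) * (r * (f (Y t) + 1/4 * (norm (Y t + \<eta> *\<^sub>R dY t))\<^sup>2)
        + inner (dY t) p + 1/2 * inner (Y t + \<eta> *\<^sub>R dY t) (dY t + \<eta> *\<^sub>R a))) (at t within S)"
proof -
  have sq: "GDERIV (\<lambda>x::'a. (norm x)\<^sup>2) x :> 2 *\<^sub>R x" for x
    unfolding gderiv_def power2_norm_eq_inner
    by (auto intro!: derivative_eq_intros simp: inner_commute)
  have "((\<lambda>u. Y u + \<eta> *\<^sub>R dY u) has_vector_derivative dY t + \<eta> *\<^sub>R a) (at t within S)"
    by (auto intro!: derivative_eq_intros Y dY)
  from gderiv_along_curve[OF this sq]
  have "((\<lambda>u. (norm (Y u + \<eta> *\<^sub>R dY u))\<^sup>2) has_real_derivative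
      inner (dY t + \<eta> *\<^sub>R a) (2 *\<^sub>R (Y t + \<eta> *\<^sub>R dY t))) (at t within S)" .
  note shifted_sq = this
  have scaled: "((\<lambda>u. exp (r * u) * (h u + 1/4 * q u)) has_real_derivative
      exp (r * t) * (r * (h t + 1/4 * q t) + h' + 1/4 * q')) (at t within S)"
    if "(q has_real_derivative q') (at t within S)" "(h has_real_derivative h') (at t within S)"
    for q h :: "real \<Rightarrow> real" and q' h'
    by (auto intro!: derivative_eq_intros that simp: algebra_simps)
  show ?thesis
    using scaled[OF shifted_sq gderiv_along_curve[OF Y grad]] by (simp add: inner_commute)
qed

text \<open>The left-hand side is \<open>e\<^bsup>-rt\<^esup> E'\<close> with \<open>r = 1 / \<eta>\<close>, \<open>y = Y\<close>, \<open>v = Y'\<close>, \<open>p = \<nabla>f(Y)\<close>, \<open>w\<close> the delayed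
  gradient, \<open>F = f(Y)\<close>, and \<open>Y' + \<eta> Y''\<close> replaced by means of the equation. The mixed terms in
  \<open>y\<close> and \<open>v\<close> cancel; Young's inequality with \<open>(1 / 4\<eta>) |y|\<^sup>2\<close> costs \<open>|p - w|\<^sup>2 / \<eta>\<close>, and with half
  of the damping \<open>(\<eta> / 4) |v|\<^sup>2\<close> it costs \<open>2 |p - w|\<^sup>2 / \<eta>\<close>.\<close>

lemma energy_dissipation:
  fixes y v p w :: "'a::real_inner"
  assumes "0 < \<eta>" and F: "F \<le> inner y p - 1/2 * (norm y)\<^sup>2"
  shows "inverse \<eta> * (F + 1/4 * (norm (y + \<eta> *\<^sub>R v))\<^sup>2)
      + inner v p + 1/2 * inner (y + \<eta> *\<^sub>R v) (- v - (2 * inverse \<eta>) *\<^sub>R w)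
    \<le> 3 * inverse \<eta> * (norm (p - w))\<^sup>2 - \<eta> / 8 * (norm v)\<^sup>2"
proof -
  have \<eta>: "inverse \<eta> * \<eta> = 1" using \<open>0 < \<eta>\<close> by simp
  have F': "inverse \<eta> * F \<le> inverse \<eta> * (inner y p - 1/2 * (norm y)\<^sup>2)"
    using F \<open>0 < \<eta>\<close> by (intro mult_left_mono) auto
  \<comment> \<open>The two squares are the defects in the two uses of Young's inequality.\<close>
  have "3 * inverse \<eta> * (norm (p - w))\<^sup>2 - \<eta> / 8 * (norm v)\<^sup>2
      - (inverse \<eta> * (inner y p - 1/2 * (norm y)\<^sup>2 + 1/4 * (norm (y + \<eta> *\<^sub>R v))\<^sup>2)
        + inner v p + 1/2 * inner (y + \<eta> *\<^sub>R v) (- v - (2 * inverse \<eta>) *\<^sub>R w))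
    = inverse \<eta> * (norm ((1/2) *\<^sub>R y - (p - w)))\<^sup>2
      + \<eta> / 8 * (norm (v - (4 * inverse \<eta>) *\<^sub>R (p - w)))\<^sup>2"
  proof -
    obtain k where k: "inverse \<eta> = k" by simp
    show ?thesis
      using \<eta> unfolding power2_norm_eq_inner inner_simps k
        inner_commute[of v y] inner_commute[of p y] inner_commute[of w y] inner_commute[of p v]
        inner_commute[of w v] inner_commute[of w p]
      by (simp add: field_simps) algebra
  qed
  also have "\<dots> \<ge> 0" using \<open>0 < \<eta>\<close> by (intro add_nonneg_nonneg mult_nonneg_nonneg) auto
  finally show ?thesis using F' by (simp add: algebra_simps)
qed

section \<open>Decay along the asynchronous flow\<close>

text \<open>Equivalent to \<open>e\<^bsup>x\<^esup> \<le> 1 + 2 x\<close>.\<close>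

lemma exp_ratio_ge:
  fixes x :: real
  assumes "0 < x" "x \<le> 1"
  shows "1 \<le> 2 * x * (exp (- x) / (1 - exp (- x)))"
proof -
  have "x\<^sup>2 \<le> x" using assms by (simp add: power2_eq_square mult_left_le)
  then have "exp x \<le> 1 + 2 * x" using exp_bound[of x] assms by simp
  then have "exp (- x) * exp x \<le> exp (- x) * (1 + 2 * x)" by (intro mult_left_mono) auto
  then have "1 - exp (- x) \<le> 2 * x * exp (- x)" by (simp add: algebra_simps flip: exp_add)
  then show ?thesis using assms by (simp add: le_divide_eq)
qed

lemma nonincreasing_on_half_line:
  fixes V :: "real \<Rightarrow> real"
  assumes deriv: "\<And>t. t0 \<le> t \<Longrightarrow> \<exists>D. (V has_real_derivative D) (at t within {t0..}) \<and> D \<le> 0"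
    and "t0 \<le> t"
  shows "V t \<le> V t0"
proof (rule DERIV_nonpos_imp_decreasing_open[OF \<open>t0 \<le> t\<close>])
  fix x assume "t0 < x"
  then have "at x within {t0..} = at x"
    by (intro at_within_interior) simp
  then show "\<exists>y. (V has_real_derivative y) (at x) \<and> y \<le> 0"
    using deriv[of x] \<open>t0 < x\<close> by auto
next
  have "continuous_on {t0..} V"
    unfolding continuous_on_eq_continuous_within using deriv DERIV_continuous by (metis atLeast_iff)
  then show "continuous_on {t0..t} V"
    by (rule continuous_on_subset) auto
qed

theorem theorem3:
  fixes f :: "real ^ 'd \<Rightarrow> real" and gradf :: "real ^ 'd \<Rightarrow> real ^ 'd"
    and blk :: "'d \<Rightarrow> nat" and n :: nat
    and L \<sigma> \<kappa> \<eta> \<tau> c0 r t0 :: real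
    and j :: "real \<Rightarrow> nat \<Rightarrow> real"
    and Y dY ddY :: "real \<Rightarrow> real ^ 'd"
    and E A c :: "real \<Rightarrow> real"
  assumes grad: "\<And>x. GDERIV f x :> gradf x"
    and sigma: "\<sigma> = 1"
    and strong: "strongly_convex_on UNIV \<sigma> f"
    and lip: "L-lipschitz_on UNIV gradf"
    and blocks: "blk ` UNIV = {1..n}"
    and block_lip: "\<And>i. i \<in> {1..n} \<Longrightarrow> block_lipschitz blk i L gradf"
    and minimizer: "\<And>x. f 0 \<le> f x"
    and min_value: "f 0 = 0"
    and kappa: "\<kappa> = L / \<sigma>"
    and eta: "\<eta> = real n * \<kappa> powr (1/2)"
    and c0: "c0 = 6 * \<kappa>\<^sup>2 * inverse \<eta> * \<tau>\<^sup>2"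
    and r: "r = inverse \<eta>"
    and tau_pos: "0 < \<tau>"
    and tau_le: "\<tau> \<le> 1 / sqrt 48 * real n * \<kappa> powr (-1/2)"
    and delay: "\<And>t i. t0 \<le> t \<Longrightarrow> i \<in> {1..n} \<Longrightarrow> 0 \<le> j t i \<and> j t i \<le> \<tau>"
    and Y_deriv: "\<And>t. t0 - \<tau> \<le> t \<Longrightarrow> (Y has_vector_derivative dY t) (at t within {t0 - \<tau>..})"
    and history: "(\<lambda>s. (norm (dY s))\<^sup>2) integrable_on {t0 - \<tau>..t0}"
    and dY_deriv: "\<And>t. t0 \<le> t \<Longrightarrow> (dY has_vector_derivative ddY t) (at t within {t0..})"
    and ode: "\<And>t. t0 \<le> t \<Longrightarrow>
      ddY t + (2 * real n powr (-1) * \<kappa> powr (-1/2)) *\<^sub>R dY t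
        + (2 * real n powr (-2) * \<kappa> powr (-1)) *\<^sub>R gradf (delayed blk j Y t) = 0"
    and c: "\<And>t. c t = c0 * (exp (- r * t)
              + exp (- r * \<tau>) / (1 - exp (- r * \<tau>)) * (exp (- r * t) - 1))"
    and E: "\<And>t. E t = exp (real n powr (-1) * \<kappa> powr (-1/2) * t)
              * (f (Y t) + 1/4 * (norm (Y t + \<eta> *\<^sub>R dY t))\<^sup>2)"
    and A: "\<And>t. A t = integral {t - \<tau>..t} (\<lambda>s. c (t - s) * (norm (dY s))\<^sup>2)"
  shows "(\<forall>t\<ge>t0. \<exists>D.
            ((\<lambda>u. E u + exp (inverse \<eta> * u) * A u) has_real_derivative D) (at t within {t0..})
            \<and> exp (- inverse \<eta> * t) * D \<le> 0)
       \<and> ((\<lambda>t. f (Y t)) \<longlongrightarrow> f 0) at_top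
       \<and> (\<lambda>t. f (Y t) - f 0) \<in> O[at_top](\<lambda>t. exp (- t * real n powr (-1) * \<kappa> powr (-1/2)))"
proof -
  define q where "q = exp (- r * \<tau>) / (1 - exp (- r * \<tau>))"
  define \<alpha> \<beta> where "\<alpha> = c0 * (1 + q)" and "\<beta> = - (c0 * q)"
  define g where "g s = (norm (dY s))\<^sup>2" for s
  define V where "V u = E u + exp (inverse \<eta> * u) * A u" for u

  have "{1..n} \<noteq> {}" using blocks by blast
  then have "1 \<le> n" by simp
  have "1 \<le> \<kappa>" using strongly_convex_lipschitz_ge[OF grad strong lip] by (simp add: sigma kappa)
  have "0 < \<eta>" "0 < r" using \<open>1 \<le> n\<close> \<open>1 \<le> \<kappa>\<close> by (auto simp: eta r)
  have half: "\<kappa> powr (-1/2) = inverse (\<kappa> powr (1/2))"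
    using powr_minus[of \<kappa> "1/2"] by simp
  have rate: "real n powr (-1) * \<kappa> powr (-1/2) = r"
    using \<open>1 \<le> n\<close> by (simp add: r eta half powr_minus)
  have \<eta>2: "\<eta>\<^sup>2 = (real n)\<^sup>2 * \<kappa>"
    using \<open>1 \<le> \<kappa>\<close> by (simp add: eta power_mult_distrib powr_half_sqrt)
  have rate2: "real n powr (-2) * \<kappa> powr (-1) = r\<^sup>2"
    using \<open>1 \<le> n\<close> \<open>1 \<le> \<kappa>\<close> by (simp add: r power_inverse \<eta>2 powr_minus)

  \<comment> \<open>The bound on \<open>\<tau>\<close> enters only in the form \<open>48 \<kappa>\<^sup>2 \<tau>\<^sup>2 \<le> \<eta>\<^sup>2\<close>.\<close>
  have "\<tau>\<^sup>2 \<le> (1 / sqrt 48 * real n * \<kappa> powr (-1/2))\<^sup>2"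
    using tau_le tau_pos by (intro power_mono) auto
  also have "\<dots> = (real n)\<^sup>2 / (48 * \<kappa>)"
    using \<open>1 \<le> \<kappa>\<close> unfolding half by (simp add: powr_half_sqrt power_mult_distrib power_divide power_inverse field_simps)
  finally have "48 * \<kappa> * \<tau>\<^sup>2 \<le> (real n)\<^sup>2"
    using \<open>1 \<le> \<kappa>\<close> by (simp add: field_simps)
  then have "\<kappa> * (48 * \<kappa> * \<tau>\<^sup>2) \<le> \<kappa> * (real n)\<^sup>2"
    using \<open>1 \<le> \<kappa>\<close> by (intro mult_left_mono) auto
  then have delay_le: "48 * (\<kappa>\<^sup>2 * \<tau>\<^sup>2) \<le> \<eta>\<^sup>2"
    unfolding \<eta>2 by (simp add: power2_eq_square mult_ac)
  have "1 * \<tau>\<^sup>2 \<le> \<kappa>\<^sup>2 * \<tau>\<^sup>2"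
    using \<open>1 \<le> \<kappa>\<close> by (intro mult_right_mono) auto
  then have "\<tau>\<^sup>2 \<le> \<eta>\<^sup>2"
    using delay_le zero_le_power2[of \<tau>] by linarith
  then have "\<tau> \<le> \<eta>"
    by (rule power2_le_imp_le) (use \<open>0 < \<eta>\<close> in simp)
  then have r\<tau>: "0 < r * \<tau>" "r * \<tau> \<le> 1"
    using \<open>0 < \<eta>\<close> tau_pos by (auto simp: r field_simps)
  \<comment> \<open>The two conditions on \<open>c0\<close>: the memory term may not exceed the damping, and it must absorb
    the error made by the delay.\<close>
  have c0_nonneg: "0 \<le> c0" using \<open>0 < \<eta>\<close> by (simp add: c0)
  have "c0 = inverse \<eta> * (48 * (\<kappa>\<^sup>2 * \<tau>\<^sup>2)) / 8" by (simp add: c0)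
  also have "\<dots> \<le> inverse \<eta> * \<eta>\<^sup>2 / 8"
    using delay_le \<open>0 < \<eta>\<close> by (intro divide_right_mono mult_left_mono) auto
  also have "inverse \<eta> * \<eta>\<^sup>2 / 8 = \<eta> / 8"
    using \<open>0 < \<eta>\<close> by (simp add: power2_eq_square)
  finally have c0_le: "c0 \<le> \<eta> / 8" .
  have "1 \<le> 2 * (r * \<tau>) * q" using exp_ratio_ge[OF r\<tau>] by (simp add: q_def)
  then have "3 * \<kappa>\<^sup>2 * \<tau> * 1 \<le> 3 * \<kappa>\<^sup>2 * \<tau> * (2 * (r * \<tau>) * q)"
    using tau_pos by (intro mult_left_mono) auto
  then have c0q_ge: "3 * (\<kappa>\<^sup>2 * \<tau>) \<le> c0 * q"
    by (simp add: c0 r power2_eq_square mult_ac)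
  have q_nonneg: "0 \<le> q" using r\<tau> by (simp add: q_def)
  have c_eq: "c u = \<alpha> * exp (- r * u) + \<beta>" for u
    unfolding c \<alpha>_def \<beta>_def q_def[symmetric] by (simp add: algebra_simps)
  have vanish: "\<alpha> * exp (- r * \<tau>) + \<beta> = 0"
  proof -
    have "q * (1 - exp (- r * \<tau>)) = exp (- r * \<tau>)"
      using \<open>0 < r\<close> tau_pos by (simp add: q_def)
    moreover have "\<alpha> * exp (- r * \<tau>) + \<beta> = c0 * (exp (- r * \<tau>) - q * (1 - exp (- r * \<tau>)))"
      by (simp add: \<alpha>_def \<beta>_def algebra_simps)
    ultimately show ?thesis by (simp only: diff_self mult_zero_right)
  qed
  have c_nonneg: "0 \<le> c u" if "u \<le> \<tau>" for u
  proof -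
    have "\<alpha> * exp (- r * \<tau>) \<le> \<alpha> * exp (- r * u)"
      using that \<open>0 < r\<close> c0_nonneg q_nonneg by (intro mult_left_mono) (auto simp: \<alpha>_def)
    then show ?thesis using vanish by (simp add: c_eq)
  qed

  have dY_cont: "continuous_on {t0..} dY"
    unfolding continuous_on_eq_continuous_within
    using dY_deriv has_vector_derivative_continuous by blast
  then have g_cont: "continuous_on {t0..} g"
    unfolding g_def[abs_def] by (intro continuous_intros)
  have g_nonneg: "0 \<le> g s" for s by (simp add: g_def)
  have g_int: "g integrable_on {t0 - \<tau>..T}" for T
  proof -
    have "g integrable_on {t0 - \<tau>..max t0 T}"
    proof (rule Henstock_Kurzweil_Integration.integrable_combine)
      show "g integrable_on {t0 - \<tau>..t0}" using history by (simp add: g_def[abs_def])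
      show "g integrable_on {t0..max t0 T}"
        by (rule integrable_continuous_interval, rule continuous_on_subset[OF g_cont]) auto
    qed (use tau_pos in auto)
    then show ?thesis by (rule integrable_on_subinterval) auto
  qed
  have A_eq: "A t = integral {t - \<tau>..t} (\<lambda>s. (\<alpha> * exp (- r * (t - s)) + \<beta>) * g s)" for t
    by (simp add: A c_eq g_def)
  have A_nonneg: "0 \<le> A t" for t
  proof (cases "(\<lambda>s. c (t - s) * g s) integrable_on {t - \<tau>..t}")
    case True
    then show ?thesis
      using c_nonneg g_nonneg unfolding A g_def[symmetric] by (intro integral_nonneg) auto
  qed (simp add: A g_def not_integrable_integral)

  have V_deriv: "\<exists>D. (V has_real_derivative D) (at t within {t0..}) \<and> exp (- inverse \<eta> * t) * D \<le> 0"
    if "t0 \<le> t" for t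
  proof -
    define w p where "w = gradf (delayed blk j Y t)" and "p = gradf (Y t)"
    define I where "I = integral {t - \<tau>..t} g"
    define e where "e = r * (f (Y t) + 1/4 * (norm (Y t + \<eta> *\<^sub>R dY t))\<^sup>2)
        + inner (dY t) p + 1/2 * inner (Y t + \<eta> *\<^sub>R dY t) (dY t + \<eta> *\<^sub>R ddY t)"
    have "(Y has_vector_derivative dY t) (at t within {t0..})"
      using that tau_pos by (intro has_vector_derivative_within_subset[OF Y_deriv]) auto
    then have dE: "(E has_real_derivative exp (r * t) * e) (at t within {t0..})"
      unfolding e_def E[abs_def] rate p_def using dY_deriv[OF that] grad by (rule energy_deriv)
    have dA: "((\<lambda>u. exp (r * u) * A u) has_real_derivative
        exp (r * t) * ((\<alpha> + \<beta>) * g t + \<beta> * r * I)) (at t within {t0..})"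
      unfolding A_eq I_def
      using g_int g_nonneg g_cont tau_pos \<open>0 < r\<close> vanish that by (rule exponential_window_deriv)
    have dV: "(V has_real_derivative exp (r * t) * (e + (c0 * g t - c0 * q * r * I))) (at t within {t0..})"
      using DERIV_add[OF dE dA] unfolding V_def r[symmetric]
      by (simp add: \<alpha>_def \<beta>_def algebra_simps)

    \<comment> \<open>The equation, solved for the derivative of \<open>Y + \<eta> Y'\<close>.\<close>
    have "ddY t + (2 * r) *\<^sub>R dY t + (2 * r\<^sup>2) *\<^sub>R w = 0"
      using ode[OF that] unfolding mult.assoc rate rate2 w_def .
    then have "ddY t = - ((2 * r) *\<^sub>R dY t) - (2 * r\<^sup>2) *\<^sub>R w"
      by (simp only: eq_diff_eq eq_neg_iff_add_eq_0 add_ac)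
    then have "\<eta> *\<^sub>R ddY t = - ((2 * (\<eta> * r)) *\<^sub>R dY t) - (2 * (\<eta> * r\<^sup>2)) *\<^sub>R w"
      by (simp add: scaleR_diff_right mult.left_commute)
    moreover have "\<eta> * r = 1" "\<eta> * r\<^sup>2 = inverse \<eta>"
      using \<open>0 < \<eta>\<close> by (auto simp: r power2_eq_square)
    ultimately have velocity: "dY t + \<eta> *\<^sub>R ddY t = - dY t - (2 * inverse \<eta>) *\<^sub>R w"
      by (simp add: scaleR_2)
    have "f (Y t) \<le> inner (Y t) p - 1/2 * (norm (Y t))\<^sup>2"
      using strongly_convex_gradient_ineq[OF strong grad[of "Y t"], of 0] by (simp add: min_value sigma p_def)
    from energy_dissipation[OF \<open>0 < \<eta>\<close> this, of "dY t" w]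
    have e_le: "e \<le> 3 * r * (norm (p - w))\<^sup>2 - \<eta> / 8 * g t"
      unfolding e_def velocity r g_def by simp

    \<comment> \<open>The gradient error is paid for by the decreasing part of the memory term.\<close>
    have "norm (p - w) \<le> \<kappa> * norm (Y t - delayed blk j Y t)"
      using lipschitz_onD[OF lip, of "Y t" "delayed blk j Y t"]
      by (simp add: p_def w_def dist_norm kappa sigma)
    then have "(norm (p - w))\<^sup>2 \<le> \<kappa>\<^sup>2 * (norm (Y t - delayed blk j Y t))\<^sup>2"
      by (metis norm_ge_zero power_mono power_mult_distrib)
    also have "(norm (Y t - delayed blk j Y t))\<^sup>2 \<le> \<tau> * I"
      unfolding I_def g_def[abs_def]
    proof (rule delayed_displacement_le)
      fix s assume "s \<in> {t - \<tau>..t}"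
      then show "(Y has_vector_derivative dY s) (at s within {t - \<tau>..t})"
        using that by (intro has_vector_derivative_within_subset[OF Y_deriv]) auto
    next
      show "(\<lambda>s. (norm (dY s))\<^sup>2) integrable_on {t - \<tau>..t}"
        using that by (intro integrable_on_subinterval[OF g_int[of t, unfolded g_def[abs_def]]]) auto
    next
      fix k
      have "blk k \<in> {1..n}" using blocks by blast
      then show "0 \<le> j t (blk k) \<and> j t (blk k) \<le> \<tau>" using delay that by blast
    qed
    finally have "(norm (p - w))\<^sup>2 \<le> \<kappa>\<^sup>2 * \<tau> * I"
      by (simp add: mult_left_mono)
    then have "3 * r * (norm (p - w))\<^sup>2 \<le> 3 * r * (\<kappa>\<^sup>2 * \<tau> * I)"
      using \<open>0 < r\<close> by (intro mult_left_mono) auto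
    also have "\<dots> = 3 * (\<kappa>\<^sup>2 * \<tau>) * (r * I)" by simp
    also have "\<dots> \<le> c0 * q * (r * I)"
    proof (rule mult_right_mono[OF c0q_ge])
      show "0 \<le> r * I"
        using \<open>0 < r\<close> g_nonneg g_int that unfolding I_def
        by (intro mult_nonneg_nonneg integral_nonneg integrable_on_subinterval[OF g_int[of t]]) auto
    qed
    finally have "e \<le> c0 * q * r * I - \<eta> / 8 * g t"
      using e_le by simp
    moreover have "c0 * g t \<le> \<eta> / 8 * g t"
      by (rule mult_right_mono[OF c0_le g_nonneg])
    ultimately have "e + (c0 * g t - c0 * q * r * I) \<le> 0" by simp
    then show ?thesis
      using dV by (auto simp: mult_le_0_iff)
  qed

  have V_mono: "V t \<le> V t0" if "t0 \<le> t" for t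
    using _ that
  proof (rule nonincreasing_on_half_line)
    fix t assume "t0 \<le> t"
    then show "\<exists>D. (V has_real_derivative D) (at t within {t0..}) \<and> D \<le> 0"
      using V_deriv[of t] by (auto simp: mult_le_0_iff)
  qed
  have decay: "0 \<le> f (Y t) \<and> f (Y t) \<le> V t0 * exp (- r * t)" if "t0 \<le> t" for t
  proof -
    have "exp (r * t) * f (Y t) \<le> E t" unfolding E rate by (simp add: mult_left_mono)
    also have "\<dots> \<le> V t" using A_nonneg[of t] by (simp add: V_def)
    also have "\<dots> \<le> V t0" by (rule V_mono[OF that])
    finally have "exp (r * t) * f (Y t) \<le> V t0" .
    then show ?thesis using minimizer[of "Y t"] min_value by (simp add: exp_minus field_simps)
  qed
  have ev: "\<forall>\<^sub>F t in at_top. 0 \<le> f (Y t) \<and> f (Y t) \<le> V t0 * exp (- r * t)"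
    using eventually_ge_at_top[of t0] by eventually_elim (rule decay)
  have "((\<lambda>t. exp (- r * t)) \<longlongrightarrow> 0) at_top"
    using \<open>0 < r\<close> by (intro filterlim_compose[OF exp_at_bot]
      filterlim_tendsto_neg_mult_at_bot[OF tendsto_const _ filterlim_ident]) auto
  then have lim0: "((\<lambda>t. V t0 * exp (- r * t)) \<longlongrightarrow> 0) at_top"
    by (rule tendsto_mult_right_zero)
  have lim: "((\<lambda>t. f (Y t)) \<longlongrightarrow> f 0) at_top"
    unfolding min_value
    by (rule tendsto_sandwich[OF _ _ tendsto_const lim0]) (use ev in \<open>auto elim: eventually_mono\<close>)
  have rate': "- t * real n powr (-1) * \<kappa> powr (-1/2) = - r * t" for t
    unfolding rate[symmetric] by simp
  have bigo: "(\<lambda>t. f (Y t) - f 0) \<in> O(\<lambda>t. exp (- t * real n powr (-1) * \<kappa> powr (-1/2)))"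
    unfolding rate' min_value
  proof (rule bigoI)
    show "\<forall>\<^sub>F t in at_top. norm (f (Y t) - 0) \<le> V t0 * norm (exp (- r * t))"
      using ev by eventually_elim simp
  qed
  from V_deriv lim bigo show ?thesis
    unfolding V_def[abs_def] by blast
qed

end
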